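(* Let $(X,T)$ be a system with a dense set of distal points. Then $\mathbb{L}_{m,r}=\overline{\mathbb{L}}_{m,r}$.
   Context: A dynamical system $(X,T)$ consists of a nonempty compact metric space $X$ (metric $d$) and a continuous surjective map $T:X\to X$; by standing assumption $X$ has no isolated points and is not a singleton. A pair $x,y\in X$ is proximal if $\liminf_{n\to\infty}d(T^nx,T^ny)=0$. A point $x\in X$ is distal if it is not proximal to any other point of the orbit closure $\overline{\{T^nx:n\ge0\}}$. $\mathbb{L}_{m,r}$ is the supremum of all $\delta>0$ such that for any finite collection $x_1,\dots,x_k$ of points in $X$ and any system of open neighborhoods $U_i\ni x_i$ ($i=1,\dots,k$) there exist points $y_i\in U_i$ and a nonnegative integer $n$ with $\min_{1\le i\le k}d(T^nx_i,T^ny_i)>\delta$. $\overline{\mathbb{L}}_{m,r}$ is the supremum of all $\delta>0$ such that for any finite collection $x_1,\dots,x_k$ of points in $X$ and any system of open neighborhoods $U_i\ni x_i$ ($i=1,\dots,k$) there exist points $y_i\in U_i$ with $\limsup_{n\to\infty}\min_{1\le i\le k}d(T^nx_i,T^ny_i)>\delta$. By convention $\sup\varnothing=0$. *)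

theory Defs
  imports "HOL-Analysis.Analysis"
begin

definition dynamical_system :: "'a::metric_space set \<Rightarrow> ('a \<Rightarrow> 'a) \<Rightarrow> bool" where
  "dynamical_system X T \<longleftrightarrow>
     X \<noteq> {} \<and> compact X \<and> continuous_on X T \<and> T ` X = X \<and>
     (\<forall>x\<in>X. x islimpt X) \<and> \<not> is_singleton X"

definition proximal :: "('a::metric_space \<Rightarrow> 'a) \<Rightarrow> 'a \<Rightarrow> 'a \<Rightarrow> bool" where
  "proximal T x y \<longleftrightarrow> liminf (\<lambda>n. ereal (dist ((T ^^ n) x) ((T ^^ n) y))) = 0"

(* For a point of a compact invariant set X, the closure in the ambient type
   coincides with the closure in X. *)
definition orbit_closure :: "('a::metric_space \<Rightarrow> 'a) \<Rightarrow> 'a \<Rightarrow> 'a set" where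
  "orbit_closure T x = closure (range (\<lambda>n. (T ^^ n) x))"

definition distal_point :: "'a::metric_space set \<Rightarrow> ('a \<Rightarrow> 'a) \<Rightarrow> 'a \<Rightarrow> bool" where
  "distal_point X T x \<longleftrightarrow>
     x \<in> X \<and> (\<forall>y\<in>orbit_closure T x. y \<noteq> x \<longrightarrow> \<not> proximal T x y)"

(* Supremum of a set of positive reals with the convention that the supremum of
   the empty set is 0; Sup {} is unspecified for type real. *)
definition sup0 :: "real set \<Rightarrow> real" where
  "sup0 A = (if A = {} then 0 else Sup A)"

(* Finite collections are families indexed by {1..k} with k >= 1, so repetitions
   are allowed.  The sets of admissible delta are bounded above by diameter X. *)
definition L_mr :: "'a::metric_space set \<Rightarrow> ('a \<Rightarrow> 'a) \<Rightarrow> real" where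
  "L_mr X T = sup0 {\<delta>. \<delta> > 0 \<and>
     (\<forall>(k::nat) x U. k \<ge> 1 \<longrightarrow>
        (\<forall>i\<in>{1..k}. x i \<in> X \<and> openin (top_of_set X) (U i) \<and> x i \<in> U i) \<longrightarrow>
        (\<exists>y n. (\<forall>i\<in>{1..k}. y i \<in> U i) \<and>
           Min ((\<lambda>i. dist ((T ^^ n) (x i)) ((T ^^ n) (y i))) ` {1..k}) > \<delta>))}"

definition L_mr_bar :: "'a::metric_space set \<Rightarrow> ('a \<Rightarrow> 'a) \<Rightarrow> real" where
  "L_mr_bar X T = sup0 {\<delta>. \<delta> > 0 \<and>
     (\<forall>(k::nat) x U. k \<ge> 1 \<longrightarrow>
        (\<forall>i\<in>{1..k}. x i \<in> X \<and> openin (top_of_set X) (U i) \<and> x i \<in> U i) \<longrightarrow>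
        (\<exists>y. (\<forall>i\<in>{1..k}. y i \<in> U i) \<and>
           limsup (\<lambda>n. ereal (Min ((\<lambda>i. dist ((T ^^ n) (x i)) ((T ^^ n) (y i))) ` {1..k})))
             > ereal \<delta>))}"

end

theory Submission
  imports Defs
begin

text \<open>
  A limit superior above \<open>\<delta>\<close> yields a single time with separation above \<open>\<delta>\<close>, so the recurrent number
  is at most the other one. For the converse it suffices that separation above \<open>\<delta>\<close> at one time
  can be upgraded to separation above any given \<open>\<delta>' < \<delta>\<close> at infinitely many times.

  If all the points $x_i$, $y_i$ were distal, their joint orbit would return near its initial
  position and the separation would repeat. The $y_i$ can be chosen distal, because separation at a fixed time
  is an open condition and distal points are dense. The $x_i$ are prescribed, and replacing them by
  nearby distal points would cost a factor of two in the constant. Instead one uses an idempotent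
  $u$ in the closure of the iterates of $T$ in $X^X$. It fixes every distal point, and since
  $uu = u$, the times approximating $u$ bring the orbits of both $x_i$ and $u(x_i)$ close to $u(x_i)$.
  If $u$ is a limit of $T^n$ where $n$ runs through times at which points of the
  $U_i$ separate from the $x_i$, one such time can be chosen at which $T^n x_i$ and $T^n u(x_i)$
  almost agree. Then $y_i$ separates from $u(x_i)$, and this persists: at later times $m$ the points
  $x_i$ and $y_i$ return jointly to the vicinity of $u(x_i)$ and $y_i$, and they are separated at
  time $n + m$ (\<open>separated_infinitely_often\<close>).

  Such an idempotent exists because the set of separation times is thick, that is, contains
  arbitrarily long blocks of consecutive numbers (\<open>thick_separation_times\<close>). This is where
  separating many points simultaneously matters: the property is applied to the $x_i$ together with
  iterated preimages of them. The limits of iterates along ever longer blocks form a compact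
  semigroup under composition, and the Ellis-Numakura lemma provides an idempotent in it (\<open>idempotent_limit\<close>).
\<close>

section \<open>Idempotents in compact semigroups\<close>

text \<open>
  A minimal nonempty closed subsemigroup $M$ exists by Zorn's lemma. For $u \in M$ both $Mu$ and
  $\{b \in M : bu = u\}$ are closed subsemigroups, the second nonempty because $Mu = M$ by
  minimality; so the second is $M$ too, and $uu = u$. The product is continuous in
  its left factor only, as composition is in the topology of pointwise convergence when the functions
  are discontinuous. Being Hausdorff is stated of the topology, so that the lemma applies to function types
  with that topology.
\<close>

lemma Ellis_Numakura:
  fixes S :: "'a::topological_space set" and m :: "'a \<Rightarrow> 'a \<Rightarrow> 'a"
  assumes Hausdorff: "Hausdorff_space (euclidean :: 'a topology)" and "compact S" "S \<noteq> {}"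
    and closed: "\<And>a b. a \<in> S \<Longrightarrow> b \<in> S \<Longrightarrow> m a b \<in> S"
    and assoc: "\<And>a b c. a \<in> S \<Longrightarrow> b \<in> S \<Longrightarrow> c \<in> S \<Longrightarrow> m (m a b) c = m a (m b c)"
    and cont: "\<And>b. b \<in> S \<Longrightarrow> continuous_on S (\<lambda>a. m a b)"
  obtains u where "u \<in> S" "m u u = u"
proof -
  define sub where "sub M \<longleftrightarrow> M \<subseteq> S \<and> M \<noteq> {} \<and> closed M \<and> (\<forall>a\<in>M. \<forall>b\<in>M. m a b \<in> M)" for M
  have compact_closed: "closed K" if "compact K" for K :: "'a set"
    using compactin_imp_closedin[OF Hausdorff, of K] that by simp
  have "sub S"
    using assms compact_closed by (auto simp: sub_def)
  \<comment> \<open>Zorn's lemma produces maximal elements, so it is applied to the complements.\<close>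
  have chain: "\<Union>\<C> \<in> uminus ` Collect sub"
    if "\<C> \<noteq> {}" and ch: "subset.chain (uminus ` Collect sub) \<C>" for \<C>
  proof -
    have mem: "sub (- C)" if "C \<in> \<C>" for C
      using ch that by (auto simp: subset_chain_def)
    have "S \<inter> (\<Inter>C\<in>\<C>. - C) \<noteq> {}"
    proof (rule compact_imp_fip_image)
      show "compact S" by fact
      show "closed (- C)" if "C \<in> \<C>" for C using mem[OF that] by (simp add: sub_def)
      show "S \<inter> (\<Inter>C\<in>\<C>'. - C) \<noteq> {}" if "finite \<C>'" "\<C>' \<subseteq> \<C>" for \<C>'
      proof (cases "\<C>' = {}")
        case True then show ?thesis using assms by simp
      next
        case False
        have "subset.chain UNIV \<C>'"
          using ch \<open>\<C>' \<subseteq> \<C>\<close> unfolding subset_chain_def by (meson subsetD subset_UNIV)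
        then have "\<Union>\<C>' \<in> \<C>'"
          using False \<open>finite \<C>'\<close> by (intro Union_in_chain) auto
        with that have "sub (- \<Union>\<C>')" using mem by blast
        then have "- \<Union>\<C>' \<subseteq> S" "- \<Union>\<C>' \<noteq> {}" by (simp_all add: sub_def)
        moreover have "(\<Inter>C\<in>\<C>'. - C) = - \<Union>\<C>'" by blast
        ultimately show ?thesis by (metis inf.absorb2)
      qed
    qed
    then have "- \<Union>\<C> \<noteq> {}" by blast
    moreover have "- \<Union>\<C> \<subseteq> S" using \<open>\<C> \<noteq> {}\<close> mem unfolding sub_def by blast
    moreover have "closed (- \<Union>\<C>)"
      using mem by (force simp: sub_def closed_Compl closed_def)
    moreover have "m a b \<in> - \<Union>\<C>" if "a \<in> - \<Union>\<C>" "b \<in> - \<Union>\<C>" for a b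
      using that mem unfolding sub_def by blast
    ultimately have "sub (- \<Union>\<C>)" by (simp add: sub_def)
    then show ?thesis by (metis (mono_tags) double_complement image_eqI mem_Collect_eq)
  qed
  have "\<exists>M\<in>uminus ` Collect sub. \<forall>N\<in>uminus ` Collect sub. M \<subseteq> N \<longrightarrow> N = M"
    using \<open>sub S\<close> chain by (intro subset_Zorn_nonempty) auto
  then obtain M where M: "sub M" and min: "\<And>N. sub N \<Longrightarrow> N \<subseteq> M \<Longrightarrow> N = M"
    by auto
  obtain u where u: "u \<in> M" using M by (auto simp: sub_def)
  have MS: "M \<subseteq> S" and "closed M" using M by (auto simp: sub_def)
  have "compact M"
    using \<open>closed M\<close> MS \<open>compact S\<close> by (metis compact_Int_closed inf.absorb2)
  have contM: "continuous_on M (\<lambda>a. m a u)"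
    using cont u MS continuous_on_subset by blast
  have "(\<lambda>a. m a u) ` M = M"
  proof (rule min)
    have "m (m a u) (m b u) = m (m (m a u) b) u" if "a \<in> M" "b \<in> M" for a b
      using that u MS closed assoc by (metis subsetD)
    moreover have "m (m a u) b \<in> M" if "a \<in> M" "b \<in> M" for a b
      using that M u by (simp add: sub_def)
    ultimately show "sub ((\<lambda>a. m a u) ` M)"
      using M u \<open>compact M\<close> contM
      by (auto simp: sub_def intro!: compact_closed compact_continuous_image)
    show "(\<lambda>a. m a u) ` M \<subseteq> M" using M u by (auto simp: sub_def)
  qed
  then obtain a where a: "a \<in> M" "m a u = u" using u by (metis imageE)
  have "{b \<in> M. m b u = u} = M"
  proof (rule min)
    have "closed {b \<in> M. m b u = u}"
      using continuous_closed_preimage[OF contM \<open>closed M\<close> compact_closed[of "{u}"]]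
      by (simp add: vimage_def Collect_conj_eq)
    moreover have "m (m b c) u = u" if "b \<in> M" "c \<in> M" "m b u = u" "m c u = u" for b c
      using that u MS assoc by (metis subsetD)
    ultimately show "sub {b \<in> M. m b u = u}"
      using M a by (auto simp: sub_def)
  qed auto
  then show thesis using u MS that by blast
qed

section \<open>Idempotent limits of iterates along a thick set\<close>

lemma closure_fun_approx:
  fixes u :: "'i \<Rightarrow> 'b::metric_space"
  assumes "u \<in> closure F" "finite I" "e > 0"
  obtains f where "f \<in> F" "\<And>i. i \<in> I \<Longrightarrow> dist (f i) (u i) < e"
proof -
  have "open {f. \<forall>i\<in>I. f i \<in> ball (u i) e}"
    using product_topology_basis'[of I "\<lambda>i. ball (u i) e" "\<lambda>i. i"] assms by simp
  moreover have "u \<in> {f. \<forall>i\<in>I. f i \<in> ball (u i) e}" using assms by simp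
  ultimately have "{f. \<forall>i\<in>I. f i \<in> ball (u i) e} \<inter> F \<noteq> {}"
    using \<open>u \<in> closure F\<close> open_Int_closure_eq_empty by blast
  then show thesis using that by (auto simp: dist_commute)
qed

text \<open>
  The length of the block also bounds its starting point from below. A thick set contains blocks of
  every length arbitrarily far out in any case, and in this form one parameter controls both.
\<close>
definition thick :: "nat set \<Rightarrow> bool" where
  "thick A \<longleftrightarrow> (\<forall>L. \<exists>n\<ge>L. {n..n + L} \<subseteq> A)"

text \<open>
  The limits of \<open>T ^^ n\<close>, where \<open>n\<close> starts longer and longer blocks of \<open>A\<close>, form a compact set \<open>S\<close>
  of functions. Thickness makes \<open>S\<close> nonempty, and it makes \<open>S\<close> closed under composition: dropping
  the first point of a long block leaves a long block, so \<open>S\<close> absorbs \<open>T\<close> from the left, hence all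
  iterates of \<open>T\<close>, hence all pointwise limits of iterates. So \<open>S\<close> contains an idempotent. The
  map is assumed to send the whole type into \<open>X\<close> in order that these functions lie in the compact
  power of \<open>X\<close>.
\<close>
lemma idempotent_limit_total:
  fixes X :: "'a::metric_space set"
  assumes "compact X" "range T \<subseteq> X" "continuous_on X T" "thick A"
  obtains u where "range u \<subseteq> X" "u \<circ> u = u"
    "\<And>N. u \<in> closure {T ^^ n | n. n > N \<and> n \<in> A}"
proof -
  define F where "F N = {T ^^ n | n. n > N \<and> {n..n + N} \<subseteq> A}" for N
  define S where "S = (\<Inter>N. closure (F N))"
  have Hausdorff: "Hausdorff_space (euclidean :: ('a \<Rightarrow> 'a) topology)"
    using Hausdorff_space_product_topology[of "\<lambda>_. euclidean :: 'a topology" "UNIV :: 'a set"]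
    by (simp add: euclidean_product_topology Hausdorff_space_euclidean)
  define K :: "('a \<Rightarrow> 'a) set" where "K = PiE UNIV (\<lambda>_. X)"
  have K_iff: "f \<in> K \<longleftrightarrow> range f \<subseteq> X" for f by (auto simp: K_def)
  have "compact K"
    using compactin_PiE[of "\<lambda>_. euclidean :: 'a topology" UNIV "\<lambda>_. X"] \<open>compact X\<close>
    by (simp add: K_def euclidean_product_topology)
  have F_K: "F N \<subseteq> K" for N
  proof
    fix f assume "f \<in> F N"
    then obtain n where "n > N" "f = T ^^ n" by (auto simp: F_def)
    then have "f = T \<circ> T ^^ (n - 1)" by (cases n) auto
    then show "f \<in> K" using \<open>range T \<subseteq> X\<close> by (auto simp: K_iff)
  qed
  then have clK: "closure (F N) \<subseteq> K" for N
    using compactin_imp_closedin[OF Hausdorff, of K] \<open>compact K\<close> F_K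
    by (simp add: closure_minimal)
  have mono: "F M \<subseteq> F N" if "N \<le> M" for M N
  proof
    fix f assume "f \<in> F M"
    then obtain n where "f = T ^^ n" "n > M" "{n..n + M} \<subseteq> A" by (auto simp: F_def)
    moreover from this that have "n > N" "{n..n + N} \<subseteq> A" by auto
    ultimately show "f \<in> F N" by (auto simp: F_def)
  qed
  have ne: "F N \<noteq> {}" for N
  proof -
    obtain n where "n \<ge> Suc N" "{n..n + Suc N} \<subseteq> A"
      using \<open>thick A\<close> unfolding thick_def by meson
    then have "T ^^ n \<in> F N" unfolding F_def by force
    then show ?thesis by blast
  qed
  \<comment> \<open>A nested family of nonempty closed subsets of a compact set.\<close>
  have "K \<inter> S \<noteq> {}"
    unfolding S_def
  proof (rule compact_imp_fip_image)
    show "K \<inter> (\<Inter>N\<in>I. closure (F N)) \<noteq> {}" if "finite I" for I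
    proof -
      have "F (Max (insert 0 I)) \<subseteq> (\<Inter>N\<in>I. closure (F N))"
      proof (rule INT_greatest)
        fix N assume "N \<in> I"
        with \<open>finite I\<close> have "N \<le> Max (insert 0 I)" by simp
        from mono[OF this] closure_subset show "F (Max (insert 0 I)) \<subseteq> closure (F N)"
          by (rule order_trans)
      qed
      moreover obtain f where "f \<in> F (Max (insert 0 I))" using ne by blast
      ultimately show ?thesis using F_K by blast
    qed
  qed (use \<open>compact K\<close> in auto)
  then have "S \<noteq> {}" by blast
  have SK: "S \<subseteq> K" using clK by (auto simp: S_def)
  have "closed S" by (auto simp: S_def)
  then have "compact S"
    using \<open>compact K\<close> SK by (metis compact_Int_closed inf.absorb2)
  have T_S: "T \<circ> f \<in> S" if "f \<in> S" for f
    unfolding S_def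
  proof
    fix N
    have "continuous_on K (\<lambda>g. T \<circ> g)"
      unfolding comp_def
    proof (rule continuous_on_coordinatewise_then_product)
      fix i
      show "continuous_on K (\<lambda>g. T (g i))"
        by (rule continuous_on_compose2[OF \<open>continuous_on X T\<close>])
          (auto simp: K_def intro: continuous_on_subset[OF continuous_on_product_coordinates])
    qed
    moreover have "(\<lambda>g. T \<circ> g) ` F (Suc N) \<subseteq> closure (F N)"
    proof -
      have "T \<circ> T ^^ n \<in> F N" if "n > Suc N" "{n..n + Suc N} \<subseteq> A" for n
      proof -
        have "{Suc n..Suc n + N} \<subseteq> A" using that by auto
        moreover have "T \<circ> T ^^ n = T ^^ Suc n" by simp
        ultimately show ?thesis using that unfolding F_def
          by (metis (mono_tags, lifting) Suc_lessD less_SucI mem_Collect_eq)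
      qed
      then show ?thesis using closure_subset by (fastforce simp: F_def[of "Suc N"])
    qed
    ultimately have "(\<lambda>g. T \<circ> g) ` closure (F (Suc N)) \<subseteq> closure (F N)"
      using clK by (intro image_closure_subset closed_closure) (rule continuous_on_subset)
    then show "T \<circ> f \<in> closure (F N)" using that by (auto simp: S_def)
  qed
  have cont: "continuous_on B (\<lambda>g. g \<circ> f)" for f :: "'a \<Rightarrow> 'a" and B :: "('a \<Rightarrow> 'a) set"
    unfolding comp_def
    by (intro continuous_on_coordinatewise_then_product
        continuous_on_subset[OF continuous_on_product_coordinates]) auto
  have comp_S: "q \<circ> f \<in> S" if "q \<in> S" "f \<in> S" for q f
  proof -
    have "T ^^ n \<circ> f \<in> S" for n
    proof (induction n)
      case (Suc n)
      have "T ^^ Suc n \<circ> f = T \<circ> (T ^^ n \<circ> f)" by (simp add: comp_assoc)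
      then show ?case using T_S[OF Suc] by (simp only:)
    qed (use \<open>f \<in> S\<close> in simp)
    then have "(\<lambda>g. g \<circ> f) ` F 0 \<subseteq> S" by (auto simp: F_def)
    then have "(\<lambda>g. g \<circ> f) ` closure (F 0) \<subseteq> S"
      by (intro image_closure_subset cont \<open>closed S\<close>)
    then show ?thesis using \<open>q \<in> S\<close> by (auto simp: S_def)
  qed
  obtain u where "u \<in> S" "u \<circ> u = u"
    by (rule Ellis_Numakura[OF Hausdorff \<open>compact S\<close> \<open>S \<noteq> {}\<close> comp_S comp_assoc cont])
  have "F N \<subseteq> {T ^^ n | n. n > N \<and> n \<in> A}" for N
    unfolding F_def by force
  then have "closure (F N) \<subseteq> closure {T ^^ n | n. n > N \<and> n \<in> A}" for N
    by (rule closure_mono)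
  then have "u \<in> closure {T ^^ n | n. n > N \<and> n \<in> A}" for N
    using \<open>u \<in> S\<close> unfolding S_def by blast
  moreover have "range u \<subseteq> X" using \<open>u \<in> S\<close> SK K_iff by blast
  ultimately show thesis using that \<open>u \<circ> u = u\<close> by blast
qed

text \<open>
  For a map that preserves \<open>X\<close> only, \<open>T\<close> is replaced off \<open>X\<close> by a constant. The last conclusion
  unfolds what it means to be a limit of the iterates \<open>T ^^ n\<close>, \<open>n \<in> A\<close>, in the topology of
  pointwise convergence.
\<close>
lemma idempotent_limit:
  fixes X :: "'a::metric_space set"
  assumes "compact X" "X \<noteq> {}" "T ` X \<subseteq> X" "continuous_on X T" "thick A"
  obtains u where "u ` X \<subseteq> X" "\<And>z. z \<in> X \<Longrightarrow> u (u z) = u z"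
    "\<And>N I e. finite I \<Longrightarrow> I \<subseteq> X \<Longrightarrow> e > 0 \<Longrightarrow>
       \<exists>n\<in>A. n > N \<and> (\<forall>z\<in>I. dist ((T ^^ n) z) (u z) < e)"
proof -
  obtain a where "a \<in> X" using \<open>X \<noteq> {}\<close> by blast
  define T' where "T' z = (if z \<in> X then T z else a)" for z
  have T'_cont: "continuous_on X T'"
    using \<open>continuous_on X T\<close> by (rule continuous_on_eq) (simp add: T'_def)
  have T'_range: "range T' \<subseteq> X" using \<open>a \<in> X\<close> \<open>T ` X \<subseteq> X\<close> by (auto simp: T'_def)
  obtain u where u: "range u \<subseteq> X" "u \<circ> u = u"
    "\<And>N. u \<in> closure {T' ^^ n | n. n > N \<and> n \<in> A}"
    by (rule idempotent_limit_total[OF \<open>compact X\<close> T'_range T'_cont \<open>thick A\<close>]) (rule that)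
  have eq: "(T' ^^ n) z = (T ^^ n) z \<and> (T ^^ n) z \<in> X" if "z \<in> X" for n z
    using that \<open>T ` X \<subseteq> X\<close> by (induction n) (auto simp: T'_def)
  show thesis
  proof
    show "u ` X \<subseteq> X" using u(1) by blast
    show "u (u z) = u z" for z using u(2) by (metis comp_apply)
    show "\<exists>n\<in>A. n > N \<and> (\<forall>z\<in>I. dist ((T ^^ n) z) (u z) < e)"
      if "finite I" "I \<subseteq> X" "e > 0" for N I e
    proof -
      obtain f where f: "f \<in> {T' ^^ n | n. n > N \<and> n \<in> A}"
        and close: "\<And>z. z \<in> I \<Longrightarrow> dist (f z) (u z) < e"
        by (rule closure_fun_approx[OF u(3) \<open>finite I\<close> \<open>e > 0\<close>]) (rule that)
      from f obtain n where n: "n > N" "n \<in> A" "f = T' ^^ n" by blast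
      moreover have "dist ((T ^^ n) z) (u z) < e" if "z \<in> I" for z
        using close[OF that] eq[of z n] that \<open>I \<subseteq> X\<close> n(3) by auto
      ultimately show ?thesis by blast
    qed
  qed
qed

text \<open>
  If \<open>u\<close> is an idempotent limit of iterates, then along the times that approximate \<open>u\<close> both \<open>y\<close> and
  \<open>u y\<close> move towards \<open>u y = u (u y)\<close>. So \<open>u y\<close> is a point of the orbit closure that is proximal to
  \<open>y\<close>, which for a distal point leaves only \<open>u y = y\<close>.
\<close>
lemma distal_point_fixed:
  assumes "distal_point X T y" "u y \<in> X" "u (u y) = u y"
    and approx: "\<And>N I e. finite I \<Longrightarrow> I \<subseteq> X \<Longrightarrow> e > 0 \<Longrightarrow>
       \<exists>n>N. \<forall>z\<in>I. dist ((T ^^ n) z) (u z) < e"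
  shows "u y = y"
proof (rule ccontr)
  assume "u y \<noteq> y"
  have "y \<in> X" using assms by (simp add: distal_point_def)
  have "u y \<in> orbit_closure T y"
    unfolding orbit_closure_def closure_approachable
    using approx[of "{y}"] \<open>y \<in> X\<close> by auto
  moreover have "proximal T y (u y)"
    unfolding proximal_def
  proof (rule antisym)
    show "liminf (\<lambda>n. ereal (dist ((T ^^ n) y) ((T ^^ n) (u y)))) \<le> 0"
    proof (rule ccontr)
      assume "\<not> ?thesis"
      then obtain e where e: "0 < ereal e"
        "ereal e < liminf (\<lambda>n. ereal (dist ((T ^^ n) y) ((T ^^ n) (u y))))"
        unfolding not_le using ereal_dense2 by blast
      have "\<forall>\<^sub>F n in sequentially. ereal e < ereal (dist ((T ^^ n) y) ((T ^^ n) (u y)))"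
        by (rule less_LiminfD[OF e(2)])
      then obtain N where N: "\<And>n. n \<ge> N \<Longrightarrow> e < dist ((T ^^ n) y) ((T ^^ n) (u y))"
        by (auto simp: eventually_sequentially)
      obtain n where n: "n > N" "dist ((T ^^ n) y) (u y) < e/2" "dist ((T ^^ n) (u y)) (u (u y)) < e/2"
        using approx[of "{y, u y}" "e/2" N] \<open>0 < ereal e\<close> \<open>y \<in> X\<close> \<open>u y \<in> X\<close> by auto
      then have "dist ((T ^^ n) y) ((T ^^ n) (u y)) < e"
        using \<open>u (u y) = u y\<close> by (metis dist_triangle_half_l)
      with N[of n] n show False by simp
    qed
    show "0 \<le> liminf (\<lambda>n. ereal (dist ((T ^^ n) y) ((T ^^ n) (u y))))"
      by (rule Liminf_bounded) simp
  qed
  ultimately show False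
    using \<open>distal_point X T y\<close> \<open>u y \<noteq> y\<close> by (simp add: distal_point_def)
qed
section \<open>Multi-sensitivity and its separation times\<close>

definition multi_sensitive :: "'a::metric_space set \<Rightarrow> ('a \<Rightarrow> 'a) \<Rightarrow> real \<Rightarrow> bool" where
  "multi_sensitive X T \<delta> \<longleftrightarrow>
     (\<forall>(k::nat) x U. k \<ge> 1 \<longrightarrow>
        (\<forall>i\<in>{1..k}. x i \<in> X \<and> openin (top_of_set X) (U i) \<and> x i \<in> U i) \<longrightarrow>
        (\<exists>y n. \<forall>i\<in>{1..k}. y i \<in> U i \<and> dist ((T ^^ n) (x i)) ((T ^^ n) (y i)) > \<delta>))"

text \<open>
  Arbitrary finite index sets are needed because below the property is applied to families indexed
  by pairs.
\<close>
lemma multi_sensitive_finite: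
  assumes "multi_sensitive X T \<delta>" "finite J" "J \<noteq> {}"
    and U: "\<And>j. j \<in> J \<Longrightarrow> x j \<in> X \<and> openin (top_of_set X) (U j) \<and> x j \<in> U j"
  obtains y n where "\<And>j. j \<in> J \<Longrightarrow> y j \<in> U j \<and> dist ((T ^^ n) (x j)) ((T ^^ n) (y j)) > \<delta>"
proof -
  obtain h where h: "bij_betw h {1..card J} J"
    using ex_bij_betw_nat_finite_1[OF \<open>finite J\<close>] by blast
  have "card J \<ge> 1" using assms by (simp add: Suc_le_eq card_gt_0_iff)
  moreover have "\<forall>i\<in>{1..card J}. (x \<circ> h) i \<in> X \<and> openin (top_of_set X) ((U \<circ> h) i) \<and> (x \<circ> h) i \<in> (U \<circ> h) i"
    using U bij_betwE[OF h] by simp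
  ultimately have "\<exists>y n. \<forall>i\<in>{1..card J}.
      y i \<in> (U \<circ> h) i \<and> dist ((T ^^ n) ((x \<circ> h) i)) ((T ^^ n) (y i)) > \<delta>"
    using assms(1)[unfolded multi_sensitive_def, THEN spec[of _ "card J"], THEN spec[of _ "x \<circ> h"],
        THEN spec[of _ "U \<circ> h"]] by simp
  then obtain y n where y: "\<And>i. i \<in> {1..card J} \<Longrightarrow>
      y i \<in> U (h i) \<and> dist ((T ^^ n) (x (h i))) ((T ^^ n) (y i)) > \<delta>"
    unfolding comp_def by meson
  define g where "g = inv_into {1..card J} h"
  have "g j \<in> {1..card J}" "h (g j) = j" if "j \<in> J" for j
    using h that unfolding g_def bij_betw_def by (metis inv_into_into, metis f_inv_into_f)
  then have "(y \<circ> g) j \<in> U j \<and> dist ((T ^^ n) (x j)) ((T ^^ n) ((y \<circ> g) j)) > \<delta>" if "j \<in> J" for j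
    using y[of "g j"] that by simp
  then show thesis by (rule that)
qed

lemma continuous_on_funpow:
  assumes "continuous_on X T" "T ` X \<subseteq> X"
  shows "continuous_on X (T ^^ n)" "(T ^^ n) ` X \<subseteq> X"
proof -
  have "continuous_on X (T ^^ n) \<and> (T ^^ n) ` X \<subseteq> X"
  proof (induction n)
    case (Suc n)
    then show ?case using assms
      by (auto intro: continuous_on_compose2[of X T])
  qed (simp_all add: id_def)
  then show "continuous_on X (T ^^ n)" "(T ^^ n) ` X \<subseteq> X" by auto
qed

definition separation_times ::
  "('a::metric_space \<Rightarrow> 'a) \<Rightarrow> real \<Rightarrow> 'i set \<Rightarrow> ('i \<Rightarrow> 'a) \<Rightarrow> ('i \<Rightarrow> 'a set) \<Rightarrow> nat set" where
  "separation_times T \<delta> J x U =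
     {n. \<forall>j\<in>J. \<exists>y\<in>U j. dist ((T ^^ n) (x j)) ((T ^^ n) y) > \<delta>}"

text \<open>
  Multi-sensitivity is applied to preimages of the points \<open>x j\<close> under \<open>T ^^ l\<close> for all \<open>l \<le> L\<close>
  simultaneously, with the preimages of \<open>U j\<close> as neighbourhoods. If these are separated at a common
  time \<open>n\<close>, then pushing the separating points forward by \<open>T ^^ l\<close> shows that \<open>n - l\<close> is a separation
  time of the original family, so \<open>n - L, \<dots>, n\<close> is a block of such times.
\<close>
lemma thick_separation_times:
  assumes "continuous_on X T" "T ` X = X" "\<delta> > 0" "multi_sensitive X T \<delta>" "finite J" "J \<noteq> {}"
    and U: "\<And>j. j \<in> J \<Longrightarrow> x j \<in> X \<and> openin (top_of_set X) (U j) \<and> x j \<in> U j"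
  shows "thick (separation_times T \<delta> J x U)"
  unfolding thick_def
proof
  fix L
  have cont: "continuous_on X (T ^^ l)" for l
    using assms by (intro continuous_on_funpow) auto
  have surj: "(T ^^ l) ` X = X" for l
  proof (induction l)
    case (Suc l)
    then show ?case using \<open>T ` X = X\<close> by (metis funpow.simps(2) image_comp)
  qed simp
  have "\<forall>p\<in>J \<times> {..L}. \<exists>z\<in>X. (T ^^ snd p) z = x (fst p)"
    using surj U by (metis imageE mem_Times_iff)
  then obtain z where z: "\<And>p. p \<in> J \<times> {..L} \<Longrightarrow> z p \<in> X \<and> (T ^^ snd p) (z p) = x (fst p)"
    by metis
  \<comment> \<open>The second factor excludes separation up to time \<open>2 * L\<close>, so that the block starts after \<open>L\<close>.\<close>
  define V where "V p = (X \<inter> (T ^^ snd p) -` U (fst p)) \<inter>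
     (\<Inter>l\<in>{..2*L}. X \<inter> (T ^^ l) -` ball ((T ^^ l) (z p)) \<delta>)" for p
  have V: "z p \<in> X \<and> openin (top_of_set X) (V p) \<and> z p \<in> V p" if "p \<in> J \<times> {..L}" for p
  proof (intro conjI)
    have "openin (top_of_set X) (X \<inter> (T ^^ snd p) -` U (fst p))"
      using U that surj by (intro continuous_openin_preimage[OF cont, where T = X]) auto
    moreover have "openin (top_of_set X) (\<Inter>l\<in>{..2*L}. X \<inter> (T ^^ l) -` ball ((T ^^ l) (z p)) \<delta>)"
      by (intro openin_INT2 continuous_openin_preimage_gen[OF cont]) auto
    ultimately show "openin (top_of_set X) (V p)"
      unfolding V_def by (rule openin_Int)
    show "z p \<in> V p" using z[OF that] U that \<open>\<delta> > 0\<close> by (auto simp: V_def)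
  qed (use z that in auto)
  have "finite (J \<times> {..L})" "J \<times> {..L} \<noteq> {}" using assms by auto
  then obtain y n where y: "\<And>p. p \<in> J \<times> {..L} \<Longrightarrow>
      y p \<in> V p \<and> dist ((T ^^ n) (z p)) ((T ^^ n) (y p)) > \<delta>"
    by (rule multi_sensitive_finite[OF \<open>multi_sensitive X T \<delta>\<close>, where x = z and U = V])
      (use V in auto)
  have "n > 2*L"
  proof (rule ccontr)
    assume "\<not> n > 2*L"
    obtain j where "j \<in> J" using \<open>J \<noteq> {}\<close> by blast
    then have "(j, 0) \<in> J \<times> {..L}" by simp
    moreover have "n \<in> {..2*L}" using \<open>\<not> n > 2*L\<close> by simp
    ultimately have "y (j, 0) \<in> (T ^^ n) -` ball ((T ^^ n) (z (j, 0))) \<delta>"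
      using y[of "(j, 0)"] unfolding V_def by blast
    with y[of "(j, 0)"] \<open>(j, 0) \<in> J \<times> {..L}\<close> show False by force
  qed
  have "m \<in> separation_times T \<delta> J x U" if "m \<in> {n - L..n - L + L}" for m
    unfolding separation_times_def
  proof (intro CollectI ballI)
    fix j assume "j \<in> J"
    define l where "l = n - m"
    have l: "l \<le> L" "n = m + l" using that \<open>n > 2*L\<close> by (auto simp: l_def)
    then have p: "(j, l) \<in> J \<times> {..L}" using \<open>j \<in> J\<close> by simp
    show "\<exists>y\<in>U j. dist ((T ^^ m) (x j)) ((T ^^ m) y) > \<delta>"
    proof
      show "(T ^^ l) (y (j, l)) \<in> U j" using y[OF p] by (simp add: V_def)
      show "dist ((T ^^ m) (x j)) ((T ^^ m) ((T ^^ l) (y (j, l)))) > \<delta>"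
        using y[OF p] z[OF p] l by (simp add: funpow_add)
    qed
  qed
  then show "\<exists>n\<ge>L. {n..n + L} \<subseteq> separation_times T \<delta> J x U"
    using \<open>n > 2*L\<close> by (intro exI[of _ "n - L"]) auto
qed

section \<open>Recurrence of separation\<close>

text \<open>
  The points \<open>x j\<close> need not be recurrent, so they are compared with \<open>u (x j)\<close> for an idempotent limit
  \<open>u\<close> along the separation times. At a suitable separation time \<open>n\<close>, the orbits of \<open>x j\<close> and of
  \<open>u (x j)\<close> are both close to \<open>u (x j)\<close>, hence to each other; so a separation of \<open>y j\<close> from \<open>x j\<close> at
  time \<open>n\<close> is also one from \<open>u (x j)\<close>. If \<open>y j\<close> is distal, it is fixed by \<open>u\<close>, so there are
  arbitrarily late times \<open>m\<close> at which \<open>x j\<close> is near \<open>u (x j)\<close> and \<open>y j\<close> is near itself. The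
  separation reappears at time \<open>n + m\<close>.
\<close>
lemma separated_infinitely_often:
  assumes "compact X" "continuous_on X T" "T ` X = X"
    and dense: "X \<subseteq> closure {x. distal_point X T x}"
    and "multi_sensitive X T \<delta>" "\<delta>' < \<delta>" "\<delta> > 0" "finite J" "J \<noteq> {}"
    and U: "\<And>j. j \<in> J \<Longrightarrow> x j \<in> X \<and> openin (top_of_set X) (U j) \<and> x j \<in> U j"
  obtains y where "\<And>j. j \<in> J \<Longrightarrow> y j \<in> U j"
    "\<And>N. \<exists>n>N. \<forall>j\<in>J. dist ((T ^^ n) (x j)) ((T ^^ n) (y j)) > \<delta>'"
proof -
  define A where "A = separation_times T \<delta> J x U"
  \<comment> \<open>A quarter of the gap: two errors at time \<open>n\<close> and two more at time \<open>n + m\<close>.\<close>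
  define e where "e = (\<delta> - \<delta>') / 4"
  have "e > 0" using \<open>\<delta>' < \<delta>\<close> by (simp add: e_def)
  have TX: "T ` X \<subseteq> X" and "X \<noteq> {}" using assms by auto
  have "thick A" unfolding A_def
    using assms by (intro thick_separation_times) auto
  obtain u where uX: "u ` X \<subseteq> X" and uu: "\<And>z. z \<in> X \<Longrightarrow> u (u z) = u z"
    and approx: "\<And>N I e. finite I \<Longrightarrow> I \<subseteq> X \<Longrightarrow> e > 0 \<Longrightarrow>
       \<exists>n\<in>A. n > N \<and> (\<forall>z\<in>I. dist ((T ^^ n) z) (u z) < e)"
    by (rule idempotent_limit[OF \<open>compact X\<close> \<open>X \<noteq> {}\<close> TX \<open>continuous_on X T\<close> \<open>thick A\<close>]) (rule that)
  have u_distal: "u y = y" if "distal_point X T y" for y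
  proof (rule distal_point_fixed[OF that])
    have "y \<in> X" using that by (simp add: distal_point_def)
    then show "u y \<in> X" "u (u y) = u y" using uX uu by auto
  qed (use approx in blast)
  have "finite (x ` J \<union> u ` x ` J)" "x ` J \<union> u ` x ` J \<subseteq> X" using \<open>finite J\<close> U uX by auto
  from approx[OF this \<open>e > 0\<close>] obtain n where "n \<in> A"
    and close: "\<forall>z\<in>x ` J \<union> u ` x ` J. dist ((T ^^ n) z) (u z) < e"
    by blast
  have n: "dist ((T ^^ n) (x j)) (u (x j)) < e" "dist ((T ^^ n) (u (x j))) (u (x j)) < e"
    if "j \<in> J" for j
    using bspec[OF close, of "x j"] bspec[OF close, of "u (x j)"] uu[of "x j"] U[OF that] that
    by auto
  note Tn = continuous_on_funpow[OF \<open>continuous_on X T\<close> TX]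
  have "\<exists>y. distal_point X T y \<and> y \<in> U j \<and> dist ((T ^^ n) (x j)) ((T ^^ n) y) > \<delta>" if "j \<in> J" for j
  proof -
    \<comment> \<open>Being separated at time \<open>n\<close> is an open condition, so a distal point satisfies it.\<close>
    define W where "W = U j \<inter> (X \<inter> (T ^^ n) -` (- cball ((T ^^ n) (x j)) \<delta>))"
    have "openin (top_of_set X) W"
      unfolding W_def using U[OF that]
      by (intro openin_Int continuous_openin_preimage_gen[OF Tn(1)]) auto
    then obtain G where G: "open G" "W = X \<inter> G" by (auto simp: openin_open)
    have "\<exists>y\<in>U j. dist ((T ^^ n) (x j)) ((T ^^ n) y) > \<delta>"
      using \<open>n \<in> A\<close> that by (simp add: A_def separation_times_def)
    then obtain y where y: "y \<in> U j" "dist ((T ^^ n) (x j)) ((T ^^ n) y) > \<delta>"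
      by blast
    moreover have "U j \<subseteq> X" using U[OF that] openin_imp_subset by blast
    ultimately have "y \<in> W" by (auto simp: W_def)
    with G dense have "y \<in> G" "y \<in> closure {x. distal_point X T x}" by auto
    then have "G \<inter> {x. distal_point X T x} \<noteq> {}"
      using open_Int_closure_eq_empty[OF \<open>open G\<close>] by blast
    then obtain w where w: "w \<in> G" "distal_point X T w" by blast
    then have "w \<in> W" using G by (simp add: distal_point_def)
    with w show ?thesis by (auto simp: W_def)
  qed
  then obtain y where y: "\<And>j. j \<in> J \<Longrightarrow> distal_point X T (y j) \<and> y j \<in> U j \<and>
      dist ((T ^^ n) (x j)) ((T ^^ n) (y j)) > \<delta>"
    by metis
  have yX: "y j \<in> X" if "j \<in> J" for j using y[OF that] by (simp add: distal_point_def)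
  have far: "dist ((T ^^ n) (u (x j))) ((T ^^ n) (y j)) > \<delta> - 2 * e" if "j \<in> J" for j
    using y[OF that] n[OF that] dist_triangle[of "(T ^^ n) (x j)" "(T ^^ n) (y j)" "u (x j)"]
      dist_triangle[of "u (x j)" "(T ^^ n) (y j)" "(T ^^ n) (u (x j))"]
    by (simp add: dist_commute)
  have "uniformly_continuous_on X (T ^^ n)"
    using Tn(1) \<open>compact X\<close> by (rule compact_uniformly_continuous)
  then obtain d where "d > 0"
    and d: "\<And>a b. a \<in> X \<Longrightarrow> b \<in> X \<Longrightarrow> dist a b < d \<Longrightarrow> dist ((T ^^ n) a) ((T ^^ n) b) < e"
    using \<open>e > 0\<close> by (metis uniformly_continuous_onE)
  show thesis
  proof
    show "y j \<in> U j" if "j \<in> J" for j using y that by blast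
    fix N
    have "finite (x ` J \<union> y ` J)" "x ` J \<union> y ` J \<subseteq> X" using \<open>finite J\<close> U yX by auto
    from approx[OF this \<open>d > 0\<close>, of N] obtain m where "m > N"
      and close: "\<forall>z\<in>x ` J \<union> y ` J. dist ((T ^^ m) z) (u z) < d"
      by blast
    have m: "dist ((T ^^ m) (x j)) (u (x j)) < d" "dist ((T ^^ m) (y j)) (y j) < d"
      if "j \<in> J" for j
      using bspec[OF close, of "x j"] bspec[OF close, of "y j"] u_distal[of "y j"] y[OF that] that
      by auto
    have "dist ((T ^^ (n + m)) (x j)) ((T ^^ (n + m)) (y j)) > \<delta>'" if "j \<in> J" for j
    proof -
      have "dist ((T ^^ n) ((T ^^ m) (x j))) ((T ^^ n) (u (x j))) < e"
           "dist ((T ^^ n) ((T ^^ m) (y j))) ((T ^^ n) (y j)) < e"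
        using m[OF that] U[OF that] yX[OF that] uX Tn(2) by (auto intro!: d)
      then have "dist ((T ^^ n) ((T ^^ m) (x j))) ((T ^^ n) ((T ^^ m) (y j))) > \<delta> - 4 * e"
        using far[OF that]
          dist_triangle[of "(T ^^ n) (u (x j))" "(T ^^ n) (y j)" "(T ^^ n) ((T ^^ m) (x j))"]
          dist_triangle[of "(T ^^ n) ((T ^^ m) (x j))" "(T ^^ n) (y j)" "(T ^^ n) ((T ^^ m) (y j))"]
        by (simp add: dist_commute)
      moreover have "\<delta> - 4 * e = \<delta>'" by (simp add: e_def field_simps)
      ultimately show ?thesis by (simp add: funpow_add)
    qed
    then show "\<exists>n>N. \<forall>j\<in>J. dist ((T ^^ n) (x j)) ((T ^^ n) (y j)) > \<delta>'"
      using \<open>m > N\<close> by (intro exI[of _ "n + m"]) auto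
  qed
qed

lemma less_limsup_if_frequently_greater:
  fixes f :: "nat \<Rightarrow> real"
  assumes "c < c'" "\<And>N. \<exists>n>N. c' < f n"
  shows "ereal c < limsup (\<lambda>n. ereal (f n))"
proof (rule ccontr)
  assume "\<not> ?thesis"
  then have "limsup (\<lambda>n. ereal (f n)) < ereal c'"
    using \<open>c < c'\<close> by (simp add: not_less) (metis less_ereal.simps(1) order_le_less_trans)
  then have "\<forall>\<^sub>F n in sequentially. ereal (f n) < ereal c'"
    by (rule Limsup_lessD)
  then obtain N where N: "\<And>n. n \<ge> N \<Longrightarrow> f n < c'"
    by (auto simp: eventually_sequentially)
  obtain n where "n > N" "c' < f n" using assms(2) by blast
  with N[of n] show False by simp
qed

section \<open>Equality of the two Lyapunov numbers\<close>

theorem proposition5p4: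
  fixes X :: "'a::metric_space set" and T :: "'a \<Rightarrow> 'a"
  assumes "dynamical_system X T"
    and "X \<subseteq> closure {x. distal_point X T x}"
  shows "L_mr X T = L_mr_bar X T"
proof -
  have X: "X \<noteq> {}" "compact X" "continuous_on X T" "T ` X = X"
    using assms(1) by (auto simp: dynamical_system_def)
  define recurrently_sensitive where "recurrently_sensitive \<delta> \<longleftrightarrow> (\<forall>(k::nat) x U. k \<ge> 1 \<longrightarrow>
        (\<forall>i\<in>{1..k}. x i \<in> X \<and> openin (top_of_set X) (U i) \<and> x i \<in> U i) \<longrightarrow>
        (\<exists>y. (\<forall>i\<in>{1..k}. y i \<in> U i) \<and>
           limsup (\<lambda>n. ereal (Min ((\<lambda>i. dist ((T ^^ n) (x i)) ((T ^^ n) (y i))) ` {1..k})))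
             > ereal \<delta>))" for \<delta>
  define P where "P = {\<delta>. \<delta> > 0 \<and> multi_sensitive X T \<delta>}"
  define Q where "Q = {\<delta>. \<delta> > 0 \<and> recurrently_sensitive \<delta>}"
  have Min_gr: "Min (f ` {1..k}) > c \<longleftrightarrow> (\<forall>i\<in>{1..k}. f i > c)" if "k \<ge> 1"
    for f :: "nat \<Rightarrow> real" and k c
    using that by (subst Min_gr_iff) auto
  have L: "L_mr X T = sup0 P"
    unfolding L_mr_def P_def multi_sensitive_def
    by (intro arg_cong[where f = sup0] Collect_cong conj_cong refl all_cong1 imp_cong)
      (simp add: Min_gr ball_conj_distrib)
  have L_bar: "L_mr_bar X T = sup0 Q"
    by (simp only: L_mr_bar_def Q_def recurrently_sensitive_def)
  have "Q \<subseteq> P"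
  proof
    fix \<delta> assume "\<delta> \<in> Q"
    have "multi_sensitive X T \<delta>"
      unfolding multi_sensitive_def
    proof (intro allI impI)
      fix k :: nat and x U
      assume k: "k \<ge> 1"
        and U: "\<forall>i\<in>{1..k}. x i \<in> X \<and> openin (top_of_set X) (U i) \<and> x i \<in> U i"
      with \<open>\<delta> \<in> Q\<close> obtain y where y: "\<forall>i\<in>{1..k}. y i \<in> U i"
        "limsup (\<lambda>n. ereal (Min ((\<lambda>i. dist ((T ^^ n) (x i)) ((T ^^ n) (y i))) ` {1..k}))) > ereal \<delta>"
        unfolding Q_def recurrently_sensitive_def by blast
      have "\<exists>n. Min ((\<lambda>i. dist ((T ^^ n) (x i)) ((T ^^ n) (y i))) ` {1..k}) > \<delta>"
      proof (rule ccontr)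
        assume "\<not> ?thesis"
        then have "limsup (\<lambda>n. ereal (Min ((\<lambda>i. dist ((T ^^ n) (x i)) ((T ^^ n) (y i))) ` {1..k}))) \<le> ereal \<delta>"
          by (intro Limsup_bounded always_eventually) (simp add: not_less)
        with y(2) show False by simp
      qed
      with y(1) k show "\<exists>y n. \<forall>i\<in>{1..k}. y i \<in> U i \<and> dist ((T ^^ n) (x i)) ((T ^^ n) (y i)) > \<delta>"
        unfolding Min_gr[OF k] by blast
    qed
    then show "\<delta> \<in> P" using \<open>\<delta> \<in> Q\<close> by (simp add: P_def Q_def)
  qed
  have below: "\<delta>' \<in> Q" if "\<delta> \<in> P" "0 < \<delta>'" "\<delta>' < \<delta>" for \<delta> \<delta>'
  proof -
    have "recurrently_sensitive \<delta>'"
      unfolding recurrently_sensitive_def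
    proof (intro allI impI)
      fix k :: nat and x U
      assume k: "k \<ge> 1"
        and U: "\<forall>i\<in>{1..k}. x i \<in> X \<and> openin (top_of_set X) (U i) \<and> x i \<in> U i"
      obtain c where c: "\<delta>' < c" "c < \<delta>" using dense[OF \<open>\<delta>' < \<delta>\<close>] by blast
      have "multi_sensitive X T \<delta>" "\<delta> > 0" using \<open>\<delta> \<in> P\<close> by (auto simp: P_def)
      then obtain y where y: "\<And>i. i \<in> {1..k} \<Longrightarrow> y i \<in> U i"
        "\<And>N. \<exists>n>N. \<forall>i\<in>{1..k}. dist ((T ^^ n) (x i)) ((T ^^ n) (y i)) > c"
        by (rule separated_infinitely_often[OF X(2-4) assms(2) _ c(2), where J = "{1..k}" and x = x and U = U])
          (use k U in auto)
      have "ereal \<delta>' < limsup (\<lambda>n. ereal (Min ((\<lambda>i. dist ((T ^^ n) (x i)) ((T ^^ n) (y i))) ` {1..k})))"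
        using y(2) by (intro less_limsup_if_frequently_greater[OF c(1)]) (simp only: Min_gr[OF k])
      with y(1) show "\<exists>y. (\<forall>i\<in>{1..k}. y i \<in> U i) \<and>
           limsup (\<lambda>n. ereal (Min ((\<lambda>i. dist ((T ^^ n) (x i)) ((T ^^ n) (y i))) ` {1..k}))) > ereal \<delta>'"
        by blast
    qed
    with \<open>0 < \<delta>'\<close> show ?thesis by (simp add: Q_def)
  qed
  \<comment> \<open>A single point already bounds the constants by the diameter.\<close>
  have bdd: "bdd_above P"
  proof (rule bdd_aboveI)
    fix \<delta> assume "\<delta> \<in> P"
    obtain a where "a \<in> X" using X by blast
    have "multi_sensitive X T \<delta>" using \<open>\<delta> \<in> P\<close> by (simp add: P_def)
    then obtain y n where yn: "\<And>j. j \<in> {()} \<Longrightarrow> y j \<in> X \<and> dist ((T ^^ n) a) ((T ^^ n) (y j)) > \<delta>"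
      by (rule multi_sensitive_finite[where J = "{()}" and x = "\<lambda>_. a" and U = "\<lambda>_. X"])
        (use \<open>a \<in> X\<close> in auto)
    have "(T ^^ n) a \<in> X" "(T ^^ n) (y ()) \<in> X"
      using continuous_on_funpow(2)[OF X(3), of n] X(4) \<open>a \<in> X\<close> yn[of "()"] by auto
    then have "dist ((T ^^ n) a) ((T ^^ n) (y ())) \<le> diameter X"
      using X(2) compact_imp_bounded diameter_bounded_bound by blast
    with yn[of "()"] show "\<delta> \<le> diameter X" by simp
  qed
  have "sup0 P = sup0 Q"
  proof (cases "P = {}")
    case True
    with \<open>Q \<subseteq> P\<close> show ?thesis by simp
  next
    case False
    then obtain \<delta> where "\<delta> \<in> P" by blast
    then have "\<delta> / 2 \<in> Q" by (intro below) (auto simp: P_def)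
    then have "Q \<noteq> {}" by blast
    have "bdd_above Q" using bdd \<open>Q \<subseteq> P\<close> by (rule bdd_above_mono)
    have "Sup P = Sup Q"
    proof (rule antisym)
      show "Sup Q \<le> Sup P" using \<open>Q \<noteq> {}\<close> bdd \<open>Q \<subseteq> P\<close> by (rule cSup_subset_mono)
      show "Sup P \<le> Sup Q"
      proof (rule cSup_least[OF False])
        fix \<delta> assume "\<delta> \<in> P"
        show "\<delta> \<le> Sup Q"
        proof (rule dense_le_bounded[of 0])
          show "0 < \<delta>" using \<open>\<delta> \<in> P\<close> by (simp add: P_def)
          show "c \<le> Sup Q" if "0 < c" "c < \<delta>" for c
            using below[OF \<open>\<delta> \<in> P\<close> that] \<open>bdd_above Q\<close> by (rule cSup_upper)
        qed
      qed
    qed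
    with False \<open>Q \<noteq> {}\<close> show ?thesis by (simp add: sup0_def)
  qed
  with L L_bar show ?thesis by simp
qed

end
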